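(* Let $k,n\ge1$ and let $S_n$ act on $[k]^n$ by $(g\cdot x)_i=x_{g^{-1}(i)}$. The stationary law of the dual Burnside kernel $Q$ on $S_n$ is $$\pi_Q(g)=\frac{k^{c(g)}}{n!\binom{n+k-1}{k-1}}=\frac{k^{c(g)}}{k(k+1)\cdots(k+n-1)}\qquad(g\in S_n),$$ where $c(g)$ is the number of cycles of $g$ (including fixed points). Thus $\pi_Q$ is the Ewens distribution on $S_n$ with parameter $k$.
   Context: For the action of $G=S_n$ on $X=[k]^n$, $[k]=\{1,\dots,k\}$: $X_g=\{x\in X:g\cdot x=x\}$, $G_x=\{g\in G:g\cdot x=x\}$; every $g\in S_n$ has a fixed word, and the dual Burnside kernel on $S_n$ is $Q(g,h)=\frac1{|X_g|}\sum_{x\in X_g\cap X_h}\frac1{|G_x|}$ (an irreducible kernel). The Ewens distribution with parameter $\theta>0$ on $S_n$ assigns to $g$ the probability $\theta^{c(g)}/(\theta(\theta+1)\cdots(\theta+n-1))$. *)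

theory Defs
  imports
    Complex_Main
    "HOL-Combinatorics.Orbits"
    "HOL-Algebra.Group_Action"
    "HOL-Algebra.Sym_Groups"
begin

definition dual_burnside_kernel ::
  "('g, 'm) monoid_scheme \<Rightarrow> 'x set \<Rightarrow> ('g \<Rightarrow> 'x \<Rightarrow> 'x) \<Rightarrow> 'g \<Rightarrow> 'g \<Rightarrow> real" where
  "dual_burnside_kernel G X \<phi> g h =
     1 / real (card (invariants X \<phi> g)) *
     (\<Sum>x \<in> invariants X \<phi> g \<inter> invariants X \<phi> h. 1 / real (card (stabilizer G \<phi> x)))"

text \<open>Meant for finite \<open>S\<close>; the values of \<open>\<pi>\<close> outside \<open>S\<close> are irrelevant.\<close>

definition stationary_law :: "'s set \<Rightarrow> ('s \<Rightarrow> 's \<Rightarrow> real) \<Rightarrow> ('s \<Rightarrow> real) \<Rightarrow> bool" where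
  "stationary_law S K \<pi> \<longleftrightarrow>
     (\<forall>s\<in>S. 0 \<le> \<pi> s) \<and> (\<Sum>s\<in>S. \<pi> s) = 1 \<and>
     (\<forall>t\<in>S. (\<Sum>s\<in>S. \<pi> s * K s t) = \<pi> t)"

definition words :: "nat \<Rightarrow> nat \<Rightarrow> (nat \<Rightarrow> nat) set" where
  "words k n = {1..n} \<rightarrow>\<^sub>E {1..k}"

text \<open>Both restrictions only fix values outside the domains of interest: the inner one makes
  the result an element of the extensional function space, the outer one makes the map an element
  of \<^term>\<open>Bij (words k n)\<close>, as the library's notion of group action requires.\<close>

definition word_action :: "nat \<Rightarrow> nat \<Rightarrow> (nat \<Rightarrow> nat) \<Rightarrow> (nat \<Rightarrow> nat) \<Rightarrow> (nat \<Rightarrow> nat)" where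
  "word_action k n g = (\<lambda>x \<in> words k n. \<lambda>i \<in> {1..n}. x (inv' g i))"

lemma word_action_closed:
  assumes "g permutes {1..n}" "x \<in> words k n"
  shows "word_action k n g x \<in> words k n"
  using assms permutes_in_image[OF permutes_inv[OF assms(1)]]
  by (auto simp: word_action_def words_def)

lemma word_action_comp:
  assumes g: "g permutes {1..n}" and h: "h permutes {1..n}" and x: "x \<in> words k n"
  shows "word_action k n (g \<circ> h) x = word_action k n g (word_action k n h x)"
proof
  fix i
  have "inv' (g \<circ> h) = inv' h \<circ> inv' g"
    using g h by (intro o_inv_distrib permutes_bij)
  moreover have "i \<in> {1..n} \<Longrightarrow> inv' g i \<in> {1..n}"
    using permutes_in_image[OF permutes_inv[OF g]] by blast
  ultimately show "word_action k n (g \<circ> h) x i = word_action k n g (word_action k n h x) i"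
    using x word_action_closed[OF h x] by (simp add: word_action_def)
qed

lemma word_action_id:
  assumes "x \<in> words k n"
  shows "word_action k n id x = x"
  using assms by (auto simp: word_action_def words_def fun_eq_iff PiE_def extensional_def)

lemma word_action_group_action: "group_action (sym_group n) (words k n) (word_action k n)"
proof (intro group_action.intro group_hom.intro group_hom_axioms.intro)
  show "group (sym_group n)" by (rule sym_group_is_group)
  show "group (BijGroup (words k n))" by (rule group_BijGroup)
  have bij: "word_action k n g \<in> Bij (words k n)" if g: "g permutes {1..n}" for g
  proof -
    note g' = permutes_inv[OF g]
    have "bij_betw (word_action k n g) (words k n) (words k n)"
      by (rule bij_betw_byWitness[where f' = "word_action k n (inv' g)"])
        (use g g' in \<open>auto simp: word_action_closed word_action_id permutes_inv_o
           simp flip: word_action_comp\<close>)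
    then show ?thesis
      by (simp add: Bij_def word_action_def)
  qed
  have comp: "word_action k n (g \<circ> h) = compose (words k n) (word_action k n g) (word_action k n h)"
    if "g permutes {1..n}" "h permutes {1..n}" for g h
  proof
    fix x
    show "word_action k n (g \<circ> h) x =
        compose (words k n) (word_action k n g) (word_action k n h) x"
      using word_action_comp[OF that]
      by (cases "x \<in> words k n") (simp_all add: compose_def word_action_def)
  qed
  show "word_action k n \<in> hom (sym_group n) (BijGroup (words k n))"
    using bij comp by (auto simp: hom_def sym_group_def BijGroup_def)
qed

text \<open>Cycles are identified with their supports, the orbits of \<open>g\<close> on \<open>{1..n}\<close>;
  fixed points contribute singleton orbits.\<close>

definition cycle_count :: "nat \<Rightarrow> (nat \<Rightarrow> nat) \<Rightarrow> nat" where
  "cycle_count n g = card (Orbits.orbit g ` {1..n})"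

definition ewens :: "real \<Rightarrow> nat \<Rightarrow> (nat \<Rightarrow> nat) \<Rightarrow> real" where
  "ewens \<theta> n g = \<theta> ^ cycle_count n g / pochhammer \<theta> n"

end

(*
  The measure g \<mapsto> |X_g| is reversible for Q, because |X_g| Q(g,h) is symmetric in g and h.
  A word is fixed by g iff it is constant on the cycles of g, so |X_g| = k^c(g). Since every
  constant word is fixed by every g, the kernel Q is strictly positive, and its stationary law is
  unique. The normalising constant is computed by induction on n: a permutation of n + 1 points is
  (n+1 b) \<circ> p with p a permutation of {1..n}, and it fixes k |X_p| words if b = n + 1 and
  |X_p| words for each of the n other b.
*)

theory Submission
  imports Defs
begin

section \<open>Strictly positive kernels\<close>

text \<open>Some state carries mass because the total is 1, and one step of a positive kernel
  spreads it to every state. Ratios against a stationary law are then well defined.\<close>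

lemma stationary_law_pos:
  assumes fin: "finite S" and K: "\<And>s t. s \<in> S \<Longrightarrow> t \<in> S \<Longrightarrow> K s t > 0"
    and st: "stationary_law S K \<pi>" and "t \<in> S"
  shows "\<pi> t > 0"
proof -
  have nn: "\<And>s. s \<in> S \<Longrightarrow> 0 \<le> \<pi> s" and total: "(\<Sum>s\<in>S. \<pi> s) = 1"
    and inv: "(\<Sum>s\<in>S. \<pi> s * K s t) = \<pi> t"
    using st \<open>t \<in> S\<close> by (auto simp: stationary_law_def)
  obtain s where s: "s \<in> S" "\<pi> s \<noteq> 0"
    using total by (metis sum.neutral zero_neq_one)
  have "0 < \<pi> s * K s t"
    using nn[OF s(1)] s K[OF s(1) \<open>t \<in> S\<close>] by simp
  then have "0 < (\<Sum>s\<in>S. \<pi> s * K s t)"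
    by (intro sum_pos2[of S s]) (use fin nn s K[OF _ \<open>t \<in> S\<close>] in \<open>auto simp: less_imp_le\<close>)
  then show ?thesis
    by (simp add: inv)
qed

text \<open>With \<open>c\<close> the least ratio \<open>\<pi>' s / \<pi> s\<close>, the invariant measure \<open>\<pi>' - c \<pi>\<close> is nonnegative
  and vanishes somewhere, so it vanishes everywhere; comparing total masses gives \<open>c = 1\<close>.\<close>

lemma stationary_law_unique:
  assumes fin: "finite S" and K: "\<And>s t. s \<in> S \<Longrightarrow> t \<in> S \<Longrightarrow> K s t > 0"
    and st: "stationary_law S K \<pi>" and st': "stationary_law S K \<pi>'" and "u \<in> S"
  shows "\<pi>' u = \<pi> u"
proof -
  have pos: "\<And>s. s \<in> S \<Longrightarrow> \<pi> s > 0"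
    using stationary_law_pos[OF fin K st] .
  define c where "c = (MIN s\<in>S. \<pi>' s / \<pi> s)"
  have "c \<in> (\<lambda>s. \<pi>' s / \<pi> s) ` S"
    unfolding c_def using fin \<open>u \<in> S\<close> by (intro Min_in) auto
  then obtain t where t: "t \<in> S" "c = \<pi>' t / \<pi> t"
    by auto
  have "c \<le> \<pi>' s / \<pi> s" if "s \<in> S" for s
    unfolding c_def using fin that by (intro Min_le) auto
  then have nn: "0 \<le> \<pi>' s - c * \<pi> s" if "s \<in> S" for s
    using pos[OF that] that by (simp flip: pos_le_divide_eq)
  \<comment> \<open>Invariance at the minimiser \<open>t\<close> writes zero as a sum of nonnegative
    terms, so every term vanishes.\<close>
  have "(\<Sum>s\<in>S. (\<pi>' s - c * \<pi> s) * K s t)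
      = (\<Sum>s\<in>S. \<pi>' s * K s t) - c * (\<Sum>s\<in>S. \<pi> s * K s t)"
    by (simp add: left_diff_distrib sum_subtractf sum_distrib_left mult.assoc)
  also have "\<dots> = \<pi>' t - c * \<pi> t"
    using st st' t(1) by (simp add: stationary_law_def)
  also have "\<dots> = 0"
    using t pos[OF t(1)] by simp
  finally have "(\<pi>' s - c * \<pi> s) * K s t = 0" if "s \<in> S" for s
    using that nn K[OF _ t(1)] fin by (subst (asm) sum_nonneg_eq_0_iff) (auto simp: less_imp_le)
  then have eq: "\<pi>' s = c * \<pi> s" if "s \<in> S" for s
    using K[OF that t(1)] that by fastforce
  have "1 = (\<Sum>s\<in>S. c * \<pi> s)"
    using st' eq by (simp add: stationary_law_def)
  also have "\<dots> = c"
    using st by (simp add: stationary_law_def flip: sum_distrib_left)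
  finally show ?thesis
    using eq[OF \<open>u \<in> S\<close>] by simp
qed

section \<open>The dual Burnside kernel of a finite group action\<close>

lemma card_stabilizer_pos:
  assumes "group_action G X \<phi>" and "finite (carrier G)" and "x \<in> X"
  shows "card (stabilizer G \<phi> x) > 0"
proof -
  interpret group_action G X \<phi> by fact
  have "\<one>\<^bsub>G\<^esub> \<in> stabilizer G \<phi> x"
    using stabilizer_subgroup[OF \<open>x \<in> X\<close>] by (rule subgroup.one_closed)
  then show ?thesis
    using assms(2) by (auto simp: card_gt_0_iff stabilizer_def)
qed

lemma dual_burnside_kernel_pos:
  assumes "group_action G X \<phi>" and "finite (carrier G)" and "finite X"
    and "x \<in> invariants X \<phi> g \<inter> invariants X \<phi> h"
  shows "dual_burnside_kernel G X \<phi> g h > 0"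
proof -
  have fin: "finite (invariants X \<phi> g)"
    using \<open>finite X\<close> by (simp add: invariants_def)
  have "card (invariants X \<phi> g) > 0"
    using fin assms(4) by (auto simp: card_gt_0_iff)
  moreover have "(\<Sum>x \<in> invariants X \<phi> g \<inter> invariants X \<phi> h. 1 / real (card (stabilizer G \<phi> x))) > 0"
    using assms(4) fin card_stabilizer_pos[OF assms(1,2)]
    by (intro sum_pos) (auto simp: invariants_def)
  ultimately show ?thesis
    by (simp add: dual_burnside_kernel_def)
qed

text \<open>The weight of \<open>g\<close> cancels the prefactor of its kernel row. After the sums
  are exchanged, each fixed point of \<open>h\<close> is counted once per element of its stabilizer,
  which the reciprocal stabilizer size undoes.\<close>

lemma dual_burnside_kernel_stationary:
  assumes act: "group_action G X \<phi>" and finG: "finite (carrier G)" and finX: "finite X"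
    and ne: "\<And>g. g \<in> carrier G \<Longrightarrow> invariants X \<phi> g \<noteq> {}"
  shows "stationary_law (carrier G) (dual_burnside_kernel G X \<phi>)
    (\<lambda>g. real (card (invariants X \<phi> g)) / (\<Sum>h\<in>carrier G. real (card (invariants X \<phi> h))))"
proof -
  interpret group_action G X \<phi> by fact
  let ?I = "invariants X \<phi>" and ?st = "\<lambda>x. card (stabilizer G \<phi> x)"
  define Z where "Z = (\<Sum>h\<in>carrier G. real (card (?I h)))"
  have finI: "finite (?I g)" for g
    using finX by (simp add: invariants_def)
  have Ipos: "card (?I g) > 0" if "g \<in> carrier G" for g
    using ne[OF that] finI by (simp add: card_gt_0_iff)
  have "carrier G \<noteq> {}"
    using group_hom by (auto simp: group_hom_def dest: group.is_monoid monoid.one_closed)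
  then have Z: "Z > 0"
    unfolding Z_def using finG Ipos by (intro sum_pos) auto
  have "(\<Sum>g\<in>carrier G. real (card (?I g)) / Z * dual_burnside_kernel G X \<phi> g h)
      = real (card (?I h)) / Z" if h: "h \<in> carrier G" for h
  proof -
    have "(\<Sum>g\<in>carrier G. real (card (?I g)) / Z * dual_burnside_kernel G X \<phi> g h)
        = (\<Sum>g\<in>carrier G. \<Sum>x\<in>?I g \<inter> ?I h. 1 / (Z * ?st x))"
      using Ipos
      by (intro sum.cong refl) (fastforce simp: dual_burnside_kernel_def sum_distrib_left)
    also have "\<dots> = (\<Sum>g\<in>carrier G. \<Sum>x\<in>{x \<in> ?I h. \<phi> g x = x}. 1 / (Z * ?st x))"
      by (intro sum.cong) (auto simp: invariants_def)
    also have "\<dots> = (\<Sum>x\<in>?I h. \<Sum>g\<in>stabilizer G \<phi> x. 1 / (Z * ?st x))"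
      unfolding stabilizer_def by (rule sum.swap_restrict[OF finG finI])
    also have "\<dots> = (\<Sum>x\<in>?I h. 1 / Z)"
      using card_stabilizer_pos[OF act finG]
      by (intro sum.cong) (auto simp: invariants_def)
    finally show ?thesis by simp
  qed
  then show ?thesis
    using Z unfolding stationary_law_def Z_def[symmetric]
    by (auto simp: Z_def simp flip: sum_divide_distrib)
qed

section \<open>Functions fixed by a permutation of their domain\<close>

text \<open>The condition uses \<open>g\<close> rather than its inverse, and the domain is an
  arbitrary set, so that points can be added one at a time in an induction.\<close>

definition fixed_functions :: "'a set \<Rightarrow> 'b set \<Rightarrow> ('a \<Rightarrow> 'a) \<Rightarrow> ('a \<Rightarrow> 'b) set" where
  "fixed_functions A B g = {x \<in> A \<rightarrow>\<^sub>E B. \<forall>i\<in>A. x (g i) = x i}"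

lemma fixed_functions_orbit:
  assumes g: "g permutes A" and x: "x \<in> fixed_functions A B g" and i: "i \<in> A"
    and j: "j \<in> Orbits.orbit g i"
  shows "x j = x i"
proof -
  from j have "j \<in> A \<and> x j = x i"
    by induction (use x i permutes_in_image[OF g] in \<open>auto simp: fixed_functions_def\<close>)
  then show ?thesis ..
qed

text \<open>A function fixed by \<open>g\<close> is constant on orbits, hence amounts to a free
  choice of one value per orbit.\<close>

lemma card_fixed_functions:
  assumes fin: "finite A" and g: "g permutes A"
  shows "card (fixed_functions A B g) = card B ^ card (Orbits.orbit g ` A)"
proof -
  let ?O = "Orbits.orbit g"
  have perm: "permutation g"
    using fin g permutation_permutes by blast
  have self: "i \<in> ?O i" for i
    by (rule permutation_self_in_orbit[OF perm])
  have step: "?O (g i) = ?O i" for i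
    by (rule permutation_orbit_step[OF perm])
  \<comment> \<open>Orbit representatives: evaluation at \<open>r C\<close> turns a fixed function
    into a function on the set of orbits.\<close>
  obtain r where r: "r (?O i) \<in> ?O i" for i
  proof
    show "(SOME j. j \<in> ?O i) \<in> ?O i" for i
      by (rule someI) (rule self)
  qed
  have r_A: "r (?O i) \<in> A" if "i \<in> A" for i
    using r permutes_orbit_subset[OF g that] by blast
  have r_O: "?O (r (?O i)) = ?O i" for i
    by (rule orbit_cyclic_eq3[OF cyclic_on_orbit'[OF perm] r])
  have "bij_betw (\<lambda>f. \<lambda>i\<in>A. f (?O i)) (?O ` A \<rightarrow>\<^sub>E B) (fixed_functions A B g)"
  proof (rule bij_betw_byWitness[where f' = "\<lambda>x. \<lambda>C\<in>?O ` A. x (r C)"])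
    show "\<forall>f\<in>?O ` A \<rightarrow>\<^sub>E B. (\<lambda>C\<in>?O ` A. (\<lambda>i\<in>A. f (?O i)) (r C)) = f"
      using r_A r_O by (auto simp: fun_eq_iff PiE_iff extensional_def)
    show "\<forall>x\<in>fixed_functions A B g. (\<lambda>i\<in>A. (\<lambda>C\<in>?O ` A. x (r C)) (?O i)) = x"
    proof
      fix x assume x: "x \<in> fixed_functions A B g"
      then have "x i = undefined" if "i \<notin> A" for i
        using that by (auto simp: fixed_functions_def)
      then show "(\<lambda>i\<in>A. (\<lambda>C\<in>?O ` A. x (r C)) (?O i)) = x"
        using fixed_functions_orbit[OF g x _ r] by (auto simp: fun_eq_iff)
    qed
    show "(\<lambda>f. \<lambda>i\<in>A. f (?O i)) ` (?O ` A \<rightarrow>\<^sub>E B) \<subseteq> fixed_functions A B g"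
      using permutes_in_image[OF g] step by (auto simp: fixed_functions_def)
    show "(\<lambda>x. \<lambda>C\<in>?O ` A. x (r C)) ` fixed_functions A B g \<subseteq> ?O ` A \<rightarrow>\<^sub>E B"
      using r_A by (auto simp: fixed_functions_def)
  qed
  then have "card (fixed_functions A B g) = card (?O ` A \<rightarrow>\<^sub>E B)"
    by (simp add: bij_betw_same_card)
  then show ?thesis
    using fin by (simp add: card_PiE)
qed

text \<open>The point \<open>a\<close> is a new singleton orbit, so the value there is a free choice
  from \<open>B\<close>.\<close>

lemma card_fixed_functions_insert_fixpoint:
  assumes a: "a \<notin> A" and p: "p permutes A"
  shows "card (fixed_functions (insert a A) B p) = card B * card (fixed_functions A B p)"
proof -
  have pa: "p a = a"
    using p a by (simp add: permutes_def)
  have pA: "p i \<in> A \<longleftrightarrow> i \<in> A" for i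
    using permutes_in_image[OF p] .
  have "bij_betw (\<lambda>(y, x). x(a := y)) (B \<times> fixed_functions A B p)
      (fixed_functions (insert a A) B p)"
    by (rule bij_betw_byWitness[where f' = "\<lambda>x. (x a, restrict x A)"])
      (use a pa pA in \<open>auto simp: fixed_functions_def fun_eq_iff PiE_iff extensional_def\<close>)
  then show ?thesis
    by (simp add: bij_betw_same_card[symmetric] card_cartesian_product)
qed

text \<open>Composing with the transposition splices \<open>a\<close> into the cycle of
  \<open>b\<close>, just before \<open>b\<close>. The value at \<open>a\<close> is thus forced to
  equal the value at \<open>b\<close>, and no other constraint arises.\<close>

lemma card_fixed_functions_insert_transpose:
  assumes a: "a \<notin> A" and p: "p permutes A" and b: "b \<in> A"
  shows "card (fixed_functions (insert a A) B (transpose a b \<circ> p)) = card (fixed_functions A B p)"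
proof -
  have pa: "p a = a"
    using p a by (simp add: permutes_def)
  have pA: "p i \<in> A \<longleftrightarrow> i \<in> A" for i
    using permutes_in_image[OF p] .
  have "bij_betw (\<lambda>x. x(a := x b)) (fixed_functions A B p)
      (fixed_functions (insert a A) B (transpose a b \<circ> p))"
  proof (rule bij_betw_byWitness[where f' = "\<lambda>x. restrict x A"])
    show "\<forall>x\<in>fixed_functions A B p. restrict (x(a := x b)) A = x"
      using a by (auto simp: fixed_functions_def fun_eq_iff PiE_iff extensional_def)
    show "\<forall>x\<in>fixed_functions (insert a A) B (transpose a b \<circ> p).
        (restrict x A)(a := restrict x A b) = x"
      using b pa by (auto simp: fixed_functions_def fun_eq_iff PiE_iff extensional_def)
    show "(\<lambda>x. x(a := x b)) ` fixed_functions A B p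
        \<subseteq> fixed_functions (insert a A) B (transpose a b \<circ> p)"
      using a b pa pA
      by (auto simp: fixed_functions_def PiE_iff extensional_def transpose_def)
    show "(\<lambda>x. restrict x A) ` fixed_functions (insert a A) B (transpose a b \<circ> p)
        \<subseteq> fixed_functions A B p"
    proof (rule image_subsetI)
      fix x assume x: "x \<in> fixed_functions (insert a A) B (transpose a b \<circ> p)"
      have xb: "x b = x a"
        using x pa by (simp add: fixed_functions_def)
      have "x (transpose a b j) = x j" for j
        using xb by (simp add: transpose_def)
      then show "restrict x A \<in> fixed_functions A B p"
        using x pA by (auto simp: fixed_functions_def)
    qed
  qed
  then show ?thesis
    by (simp add: bij_betw_same_card)
qed

text \<open>In view of \<open>card_fixed_functions\<close> this is the generating function of
  permutations by number of cycles. Counting fixed functions avoids tracking how orbits change when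
  a point is inserted.\<close>

lemma sum_card_fixed_functions:
  assumes "finite A"
  shows "(\<Sum>g | g permutes A. card (fixed_functions A B g)) = pochhammer (card B) (card A)"
  using assms
proof (induction A)
  case empty
  then show ?case by (simp add: fixed_functions_def)
next
  case (insert a A)
  have "(\<Sum>g | g permutes insert a A. card (fixed_functions (insert a A) B g))
      = (\<Sum>b\<in>insert a A. \<Sum>p | p permutes A.
          card (fixed_functions (insert a A) B (transpose a b \<circ> p)))"
    by (rule sum_over_permutations_insert[OF insert.hyps])
  \<comment> \<open>For \<open>b = a\<close> the transposition is the identity and \<open>a\<close>
    is a fixed point; every other \<open>b\<close> lies in \<open>A\<close>.\<close>
  also have "\<dots> = (\<Sum>p | p permutes A. card B * card (fixed_functions A B p))
      + (\<Sum>b\<in>A. \<Sum>p | p permutes A. card (fixed_functions A B p))"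
    using insert.hyps
    by (simp add: card_fixed_functions_insert_fixpoint card_fixed_functions_insert_transpose)
  also have "\<dots> = (card B + card A) * (\<Sum>p | p permutes A. card (fixed_functions A B p))"
    by (simp add: distrib_right flip: sum_distrib_left)
  also have "\<dots> = pochhammer (card B) (card (insert a A))"
    using insert by (simp add: pochhammer_rec')
  finally show ?case .
qed

section \<open>The symmetric group acting on words\<close>

text \<open>The action reads letters at inverse images, but invariance under \<open>g\<close> and
  under its inverse are equivalent.\<close>

lemma invariants_word_action:
  assumes g: "g permutes {1..n}"
  shows "invariants (words k n) (word_action k n) g = fixed_functions {1..n} {1..k} g"
proof (rule Set.set_eqI)
  fix x :: "nat \<Rightarrow> nat"
  have "(\<forall>i\<in>{1..n}. x (inv' g i) = x i) \<longleftrightarrow> (\<forall>i\<in>{1..n}. x (g i) = x i)"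
    using permutes_in_image[OF g] permutes_in_image[OF permutes_inv[OF g]] permutes_inverses[OF g]
    by metis
  moreover have "word_action k n g x = x \<longleftrightarrow> (\<forall>i\<in>{1..n}. x (inv' g i) = x i)"
    if "x \<in> words k n"
    using that by (auto simp: word_action_def words_def fun_eq_iff PiE_iff extensional_def)
  ultimately show "x \<in> invariants (words k n) (word_action k n) g
      \<longleftrightarrow> x \<in> fixed_functions {1..n} {1..k} g"
    by (auto simp: invariants_def fixed_functions_def words_def)
qed

lemma card_invariants_word_action:
  assumes "g permutes {1..n}"
  shows "card (invariants (words k n) (word_action k n) g) = k ^ cycle_count n g"
  using card_fixed_functions[OF _ assms, of "{1..k}"]
  by (simp add: invariants_word_action[OF assms] cycle_count_def)

lemma sum_card_invariants_word_action:
  "(\<Sum>g\<in>carrier (sym_group n). real (card (invariants (words k n) (word_action k n) g)))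
    = pochhammer (real k) n"
proof -
  have "(\<Sum>g | g permutes {1..n}. card (invariants (words k n) (word_action k n) g))
      = pochhammer k n"
    using sum_card_fixed_functions[of "{1..n}" "{1..k}"] by (simp add: invariants_word_action)
  then show ?thesis
    by (simp add: sym_group_def pochhammer_of_nat flip: of_nat_sum)
qed

lemma pochhammer_eq_fact_binomial:
  assumes "k \<ge> 1"
  shows "pochhammer (real k) n = fact n * real ((n + k - 1) choose (k - 1))"
proof -
  \<comment> \<open>The factor \<open>fact (k - 1)\<close> completes the rising factorial to a full
    factorial; \<open>k \<ge> 1\<close> keeps the subtractions from truncating.\<close>
  have "pochhammer (real k) n * fact (k - 1) = fact (n + k - 1)"
  proof (induction n)
    case (Suc n)
    have "pochhammer (real k) (Suc n) * fact (k - 1) = real (n + k) * fact (n + k - 1)"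
      using Suc.IH by (simp add: pochhammer_rec' add.commute mult.assoc)
    also have "\<dots> = fact (n + k)"
      using assms by (intro fact_reduce[symmetric]) simp
    finally show ?case by simp
  qed simp
  moreover have "real ((n + k - 1) choose (k - 1)) = fact (n + k - 1) / (fact (k - 1) * fact n)"
    using assms by (subst binomial_fact) auto
  ultimately show ?thesis
    by (metis (no_types, lifting) fact_nonzero mult.commute nonzero_mult_div_cancel_left
        times_divide_eq_right mult_divide_mult_cancel_left)
qed

theorem theorem5p14:
  fixes k n :: nat
  assumes "k \<ge> 1" and "n \<ge> 1"
  shows "\<exists>\<pi>.
    stationary_law (carrier (sym_group n))
      (dual_burnside_kernel (sym_group n) (words k n) (word_action k n)) \<pi> \<and>
    (\<forall>\<pi>'. stationary_law (carrier (sym_group n))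
        (dual_burnside_kernel (sym_group n) (words k n) (word_action k n)) \<pi>' \<longrightarrow>
      (\<forall>g \<in> carrier (sym_group n). \<pi>' g = \<pi> g)) \<and>
    (\<forall>g \<in> carrier (sym_group n).
      \<pi> g = real k ^ cycle_count n g / (fact n * real ((n + k - 1) choose (k - 1))) \<and>
      \<pi> g = real k ^ cycle_count n g / (\<Prod>i<n. real k + real i) \<and>
      \<pi> g = ewens (real k) n g)"
proof (intro exI conjI allI impI ballI)
  let ?I = "invariants (words k n) (word_action k n)"
  let ?S = "carrier (sym_group n)"
  let ?K = "dual_burnside_kernel (sym_group n) (words k n) (word_action k n)"
  let ?\<pi> = "\<lambda>g. real (card (?I g)) / (\<Sum>h\<in>?S. real (card (?I h)))"
  have finS: "finite ?S"
    by (simp add: sym_group_def finite_permutations)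
  have finX: "finite (words k n)"
    by (simp add: words_def finite_PiE)
  \<comment> \<open>The letter 1 exists as \<open>k \<ge> 1\<close>. This one word supplies both the
    nonempty fixed sets for stationarity and the common fixed points for positivity.\<close>
  have const: "(\<lambda>i\<in>{1..n}. 1) \<in> ?I g" if "g \<in> ?S" for g
  proof -
    have g: "g permutes {1..n}"
      using that by (simp add: sym_group_carrier)
    then show ?thesis
      using \<open>k \<ge> 1\<close> permutes_in_image[OF g]
      by (simp add: invariants_word_action fixed_functions_def)
  qed
  show st: "stationary_law ?S ?K ?\<pi>"
    using const by (intro dual_burnside_kernel_stationary word_action_group_action finS finX) auto
  have pos: "?K g h > 0" if "g \<in> ?S" "h \<in> ?S" for g h
    using const that by (intro dual_burnside_kernel_pos word_action_group_action finS finX) auto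
  show "\<pi>' g = ?\<pi> g" if "stationary_law ?S ?K \<pi>'" "g \<in> ?S" for \<pi>' g
    using stationary_law_unique[OF finS pos st that] .
  fix g assume "g \<in> ?S"
  then have "?\<pi> g = real k ^ cycle_count n g / pochhammer (real k) n"
    unfolding sum_card_invariants_word_action
    by (simp add: card_invariants_word_action sym_group_carrier)
  then show "?\<pi> g = real k ^ cycle_count n g / (fact n * real ((n + k - 1) choose (k - 1)))"
    and "?\<pi> g = real k ^ cycle_count n g / (\<Prod>i<n. real k + real i)"
    and "?\<pi> g = ewens (real k) n g"
    by (simp_all only: pochhammer_eq_fact_binomial[OF \<open>k \<ge> 1\<close>, symmetric] ewens_def)
      (simp add: pochhammer_prod atLeast0LessThan)
qed

end
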